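(* Let $H=(a_1,a_2)\subset\mathbb{R}$ be a bounded open interval, $\mathcal{B}$ a finite index set, and $m\ge 3$ an integer. Assume (H5.1): for each $b\in\mathcal{B}$, $g_b\in C^m(\bar H)$, $\theta_b\in C^m(\bar H)$, $g_b(x)>0$ on $\bar H$, $\theta_b(H)\subset H$; and there exist an integer $\mu\ge1$ and a real $\kappa<1$ such that $|\theta_\omega(x)-\theta_\omega(y)|\le\kappa|x-y|$ for all $\omega\in\mathcal{B}_\mu$ and $x,y\in\bar H$. Let $s>0$ and, with all suprema taken over $\omega\in\mathcal{B}_\mu$ and $x\in\bar H$, define $C_1=\sup |g_\omega'|/g_\omega$, $M_1=C_1s/(1-\kappa)$, $E_2=\sup|\theta_\omega''|$, $K_2=\sup |g_\omega''g_\omega-(1-s)(g_\omega')^2|/g_\omega^2$, $M_2=(sK_2+2sC_1M_1\kappa+M_1E_2)/(1-\kappa^2)$, $C_3=\sup |D^3g_\omega|/g_\omega$, $E_3=\sup|D^3\theta_\omega|$, and $$K_3=\sup\frac{|(s-1)(s-2)[g_\omega'(x)]^3+3(s-1)g_\omega(x)g_\omega'(x)g_\omega''(x)+[g_\omega(x)]^2g_\omega'''(x)|}{[g_\omega(x)]^3}.$$ If $v_s$ is the normalized strictly positive eigenfunction of $\Lambda_s:C^m(\bar H)\to C^m(\bar H)$ with eigenvalue $r(\Lambda_s)$, then $$\sup\Big\{\frac{|D^3v_s(x)|}{v_s(x)}:x\in\bar H\Big\}\le M_3,$$ where $(1-\kappa^3)M_3=sK_3+3sK_2M_1\kappa+3sC_1(M_2\kappa^2+M_1E_2)+3M_2\kappa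 E_2+M_1E_3$.
   Context: $D=d/dx$. For $\nu\ge1$, $\mathcal{B}_\nu=\{\omega=(b_1,\dots,b_\nu): b_j\in\mathcal{B}\}$. For $\omega=(b_1,\dots,b_\nu)$, $\theta_\omega=\theta_{b_\nu}\circ\cdots\circ\theta_{b_1}$ and $g_\omega(x)=g_{b_\nu}(\theta_{b_{\nu-1}}\circ\cdots\circ\theta_{b_1}(x))\cdots g_{b_2}(\theta_{b_1}(x))\,g_{b_1}(x)$. For $s\ge0$, $L_s:C(\bar H)\to C(\bar H)$ is $(L_sw)(x)=\sum_{b\in\mathcal{B}}[g_b(x)]^s w(\theta_b(x))$, and $\Lambda_s$ is its restriction to the Banach space $C^m(\bar H)$; $r(\Lambda_s)$ is its spectral radius. The strictly positive eigenfunction is unique up to positive scalar multiples. *)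

theory Defs
  imports "HOL-Analysis.Analysis"
begin

text \<open>
  Functions on the closure of \<open>H = (a1, a2)\<close> are functions on all of \<open>real\<close> of which only the
  values on \<open>S = {a1..a2}\<close> matter: derivatives are taken within \<open>S\<close>, hence are one-sided at the
  endpoints, and every notion below is insensitive to values outside \<open>S\<close>.
\<close>

definition nderiv :: "real set \<Rightarrow> nat \<Rightarrow> (real \<Rightarrow> 'a::real_normed_vector) \<Rightarrow> real \<Rightarrow> 'a" where
  "nderiv S k f = ((\<lambda>h x. vector_derivative h (at x within S)) ^^ k) f"

definition Cm :: "nat \<Rightarrow> real set \<Rightarrow> (real \<Rightarrow> 'a::real_normed_vector) set" where
  "Cm m S = {f. (\<forall>k<m. nderiv S k f differentiable_on S) \<and> continuous_on S (nderiv S m f)}"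

definition Cm_norm :: "nat \<Rightarrow> real set \<Rightarrow> (real \<Rightarrow> 'a::real_normed_vector) \<Rightarrow> real" where
  "Cm_norm m S f = (SUP (k, x)\<in>{..m} \<times> S. norm (nderiv S k f x))"

text \<open>
  The operator \<open>L\<^sub>s\<close>. The value type is left polymorphic so that the same definition gives the
  operator on real functions and its complexification on complex-valued functions.
\<close>

definition pf_op ::
  "'b set \<Rightarrow> ('b \<Rightarrow> real \<Rightarrow> real) \<Rightarrow> ('b \<Rightarrow> real \<Rightarrow> real) \<Rightarrow> real
    \<Rightarrow> (real \<Rightarrow> 'a::real_normed_vector) \<Rightarrow> real \<Rightarrow> 'a" where
  "pf_op B g \<theta> s w x = (\<Sum>b\<in>B. (g b x powr s) *\<^sub>R w (\<theta> b x))"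

text \<open>
  The spectrum of an operator \<open>T\<close> on the complex Banach space \<open>C\<^sup>m(S; \<complex>)\<close>, the complexification of
  the real space \<open>C\<^sup>m(S)\<close>. A point \<open>z\<close> is in the resolvent set when \<open>z - T\<close> has a bounded inverse,
  i.e. it is onto and bounded below; the lower bound includes injectivity. Equality in \<open>C\<^sup>m(S)\<close> is
  equality on \<open>S\<close>.
\<close>

definition Cm_resolvent_set ::
  "nat \<Rightarrow> real set \<Rightarrow> ((real \<Rightarrow> complex) \<Rightarrow> real \<Rightarrow> complex) \<Rightarrow> complex set" where
  "Cm_resolvent_set m S T = {z.
     (\<forall>h\<in>Cm m S. \<exists>f\<in>Cm m S. \<forall>x\<in>S. z * f x - T f x = h x) \<and>
     (\<exists>K. \<forall>f\<in>Cm m S. Cm_norm m S f \<le> K * Cm_norm m S (\<lambda>x. z * f x - T f x))}"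

definition Cm_spectrum ::
  "nat \<Rightarrow> real set \<Rightarrow> ((real \<Rightarrow> complex) \<Rightarrow> real \<Rightarrow> complex) \<Rightarrow> complex set" where
  "Cm_spectrum m S T = - Cm_resolvent_set m S T"

definition Cm_spectral_radius ::
  "nat \<Rightarrow> real set \<Rightarrow> ((real \<Rightarrow> complex) \<Rightarrow> real \<Rightarrow> complex) \<Rightarrow> real" where
  "Cm_spectral_radius m S T = (SUP z\<in>Cm_spectrum m S T. cmod z)"

text \<open>
  A word \<open>(b\<^sub>1, \<dots>, b\<^sub>\<nu>)\<close> is the list \<open>[b\<^sub>1, \<dots>, b\<^sub>\<nu>]\<close>. The map \<open>fold \<theta>\<close> applies the letters from
  left to right, so \<open>\<theta>\<^sub>\<omega>\<close> applies the map of \<open>b\<^sub>1\<close> first. In \<open>g\<^sub>\<omega>\<close> the index \<open>j\<close> is zero-based: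
  \<open>\<omega> ! j\<close> is \<open>b\<close> with subscript \<open>j + 1\<close>.
\<close>

definition words :: "'b set \<Rightarrow> nat \<Rightarrow> 'b list set" where
  "words B \<nu> = {\<omega>. set \<omega> \<subseteq> B \<and> length \<omega> = \<nu>}"

definition theta_word :: "('b \<Rightarrow> real \<Rightarrow> real) \<Rightarrow> 'b list \<Rightarrow> real \<Rightarrow> real" where
  "theta_word \<theta> \<omega> = fold \<theta> \<omega>"

definition g_word ::
  "('b \<Rightarrow> real \<Rightarrow> real) \<Rightarrow> ('b \<Rightarrow> real \<Rightarrow> real) \<Rightarrow> 'b list \<Rightarrow> real \<Rightarrow> real" where
  "g_word g \<theta> \<omega> x = (\<Prod>j<length \<omega>. g (\<omega> ! j) (theta_word \<theta> (take j \<omega>) x))"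

end

theory Submission
  imports Defs
begin

text \<open>
  Iterating the eigenvalue equation \<open>\<mu>\<close> times gives
  \<open>r\<^sup>\<mu> v(x) = (\<Sum>\<omega>. g\<^sub>\<omega>(x)\<^sup>s v(\<theta>\<^sub>\<omega>(x)))\<close>, a sum of positive terms. After \<open>k \<le> 3\<close>
  differentiations, every term involves derivatives of \<open>v\<close> of order less than \<open>k\<close>, already bounded
  relative to \<open>v\<close>, and one copy of \<open>D\<^sup>kv(\<theta>\<^sub>\<omega>(x)) \<theta>\<^sub>\<omega>'(x)\<^sup>k\<close>, where \<open>\<bar>\<theta>\<^sub>\<omega>'\<bar> \<le> \<kappa>\<close>. Hence
  \<open>N = sup \<bar>D\<^sup>kv\<bar> / v\<close> satisfies \<open>N \<le> A\<^sub>k + \<kappa>\<^sup>k N\<close>.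
\<close>

section \<open>Triples of derivatives within a set\<close>

text \<open>The derivatives are explicit arguments, so that the product, chain and power rules
  become identities between formulas; \<open>nderiv\<close> rests on the choice operator
  \<open>vector_derivative\<close> and is matched with such witnesses afterwards. Continuity of
  \<open>f3\<close> is included because suprema and maxima involving third derivatives are taken
  over a compact set.\<close>

definition has_derivs3 ::
  "real set \<Rightarrow> (real \<Rightarrow> real) \<Rightarrow> (real \<Rightarrow> real) \<Rightarrow> (real \<Rightarrow> real) \<Rightarrow> (real \<Rightarrow> real) \<Rightarrow> bool" where
  "has_derivs3 S f f1 f2 f3 \<longleftrightarrow>
     (\<forall>x\<in>S. (f has_real_derivative f1 x) (at x within S)) \<and>
     (\<forall>x\<in>S. (f1 has_real_derivative f2 x) (at x within S)) \<and>
     (\<forall>x\<in>S. (f2 has_real_derivative f3 x) (at x within S)) \<and>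
     continuous_on S f3"

lemma has_derivs3D:
  assumes "has_derivs3 S f f1 f2 f3"
  shows "x \<in> S \<Longrightarrow> (f has_real_derivative f1 x) (at x within S)"
    and "x \<in> S \<Longrightarrow> (f1 has_real_derivative f2 x) (at x within S)"
    and "x \<in> S \<Longrightarrow> (f2 has_real_derivative f3 x) (at x within S)"
  using assms by (auto simp: has_derivs3_def)

lemma has_derivs3_continuous:
  assumes "has_derivs3 S f f1 f2 f3"
  shows "continuous_on S f" "continuous_on S f1" "continuous_on S f2" "continuous_on S f3"
  using assms by (auto simp: has_derivs3_def intro!: DERIV_continuous_on)

lemma has_derivs3_cong:
  assumes "has_derivs3 S f f1 f2 f3"
    and "\<And>x. x \<in> S \<Longrightarrow> f x = h x" "\<And>x. x \<in> S \<Longrightarrow> f1 x = h1 x"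
    and "\<And>x. x \<in> S \<Longrightarrow> f2 x = h2 x" "\<And>x. x \<in> S \<Longrightarrow> f3 x = h3 x"
  shows "has_derivs3 S h h1 h2 h3"
  unfolding has_derivs3_def
proof (intro conjI ballI)
  note D = has_derivs3D[OF assms(1)]
  fix x assume x: "x \<in> S"
  show "(h has_real_derivative h1 x) (at x within S)"
    using has_field_derivative_transform_within[OF D(1)[OF x] zero_less_one x] assms x by auto
  show "(h1 has_real_derivative h2 x) (at x within S)"
    using has_field_derivative_transform_within[OF D(2)[OF x] zero_less_one x] assms x by auto
  show "(h2 has_real_derivative h3 x) (at x within S)"
    using has_field_derivative_transform_within[OF D(3)[OF x] zero_less_one x] assms x by auto
next
  show "continuous_on S h3"
    using has_derivs3_continuous(4)[OF assms(1)] assms(5) by (simp cong: continuous_on_cong)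
qed

text \<open>Every point of a nondegenerate interval, endpoints included, is a limit point of it, so
  derivatives within it are unique. The orders are taken in turn: agreement of one derivative on the
  whole interval is what allows the next to be compared. This serves to equate the derivatives of
  both sides of the iterated eigenvalue equation.\<close>

lemma has_derivs3_unique:
  assumes "a < b" "has_derivs3 {a..b} f f1 f2 f3" "has_derivs3 {a..b} h h1 h2 h3"
    and "\<And>x. x \<in> {a..b} \<Longrightarrow> f x = h x" and x: "x \<in> {a..b}"
  shows "f1 x = h1 x" "f2 x = h2 x" "f3 x = h3 x"
proof -
  note D = has_derivs3D[OF assms(2)] has_derivs3D[OF assms(3)]
  have unique: "u' = w'"
    if "(u has_real_derivative u') (at y within {a..b})"
      "(w has_real_derivative w') (at y within {a..b})"
      "\<And>y. y \<in> {a..b} \<Longrightarrow> u y = w y" "y \<in> {a..b}" for u w u' w' y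
  proof -
    have "(w has_real_derivative u') (at y within {a..b})"
      using has_field_derivative_transform_within[OF that(1) zero_less_one that(4)] that(3) by auto
    then show ?thesis
      using vector_derivative_unique_within_closed_interval[OF \<open>a < b\<close>, of y w u' w'] that(2,4)
      by (simp add: has_real_derivative_iff_has_vector_derivative)
  qed
  have 1: "f1 y = h1 y" if "y \<in> {a..b}" for y
    using unique[OF D(1)[OF that] D(4)[OF that] assms(4) that] .
  have 2: "f2 y = h2 y" if "y \<in> {a..b}" for y
    using unique[OF D(2)[OF that] D(5)[OF that] 1 that] .
  have 3: "f3 y = h3 y" if "y \<in> {a..b}" for y
    using unique[OF D(3)[OF that] D(6)[OF that] 2 that] .
  show "f1 x = h1 x" "f2 x = h2 x" "f3 x = h3 x"
    using 1 2 3 x by auto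
qed

lemma nderiv_Suc: "nderiv S (Suc k) f = (\<lambda>x. vector_derivative (nderiv S k f) (at x within S))"
  by (simp add: nderiv_def)

lemma has_derivs3_nderiv_Cm:
  fixes f :: "real \<Rightarrow> real"
  assumes "f \<in> Cm m S" "m \<ge> 3"
  shows "has_derivs3 S f (nderiv S 1 f) (nderiv S 2 f) (nderiv S 3 f)"
proof -
  have D: "(nderiv S k f has_real_derivative nderiv S (Suc k) f x) (at x within S)"
    if "k < m" "x \<in> S" for k x
  proof -
    have "nderiv S k f differentiable at x within S"
      using assms(1) that by (auto simp: Cm_def differentiable_on_def)
    then show ?thesis
      by (simp add: has_real_derivative_iff_has_vector_derivative nderiv_Suc
            vector_derivative_works)
  qed
  have "continuous_on S (nderiv S 3 f)"
  \<comment> \<open>For \<open>m = 3\<close> continuity is the last clause of \<open>Cm\<close>; for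
    larger \<open>m\<close> the third derivative is itself differentiable.\<close>
  proof (cases "m = 3")
    case True
    then show ?thesis using assms by (auto simp: Cm_def)
  next
    case False
    then show ?thesis
      using assms by (auto simp: Cm_def intro!: differentiable_imp_continuous_on)
  qed
  then show ?thesis
    using D[of 0] D[of 1] D[of 2] assms(2)
    by (auto simp: has_derivs3_def nderiv_def eval_nat_numeral)
qed

text \<open>Words get their derivatives from the calculus rules, whereas the constants are stated
  with \<open>nderiv\<close>; on an interval with \<open>a < b\<close> any witnesses coincide with
  it.\<close>

lemma has_derivs3_nderiv:
  assumes "a < b" "has_derivs3 {a..b} f f1 f2 f3"
  shows "has_derivs3 {a..b} f (nderiv {a..b} 1 f) (nderiv {a..b} 2 f) (nderiv {a..b} 3 f)"
proof -
  note D = has_derivs3D[OF assms(2)]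
  \<comment> \<open>Each \<open>nderiv\<close> is identified only on the interval, hence the passage
    from \<open>w\<close> to a function \<open>u\<close> that agrees with it there.\<close>
  have step: "vector_derivative u (at x within {a..b}) = w'"
    if "(w has_real_derivative w') (at x within {a..b})"
      "\<And>y. y \<in> {a..b} \<Longrightarrow> w y = u y" "x \<in> {a..b}" for u w w' x
  proof (rule vector_derivative_within_cbox[of a b, unfolded cbox_interval])
    show "(u has_vector_derivative w') (at x within {a..b})"
      using has_field_derivative_transform_within[OF that(1) zero_less_one that(3)] that(2)
      by (simp add: has_real_derivative_iff_has_vector_derivative)
  qed (use assms that in auto)
  have 1: "nderiv {a..b} 1 f x = f1 x" if "x \<in> {a..b}" for x
    using step[OF D(1)[OF that] _ that, of f] by (simp add: nderiv_def)
  have 2: "nderiv {a..b} 2 f x = f2 x" if "x \<in> {a..b}" for x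
    using step[OF D(2)[OF that] _ that, of "nderiv {a..b} 1 f"] 1
      nderiv_Suc[of "{a..b}" 1 f] by (simp add: numeral_2_eq_2)
  have 3: "nderiv {a..b} 3 f x = f3 x" if "x \<in> {a..b}" for x
    using step[OF D(3)[OF that] _ that, of "nderiv {a..b} 2 f"] 2
      nderiv_Suc[of "{a..b}" 2 f] by (simp add: numeral_3_eq_3 numeral_2_eq_2)
  show ?thesis
    using has_derivs3_cong[OF assms(2)] 1 2 3 by metis
qed

section \<open>Calculus rules up to order three\<close>

lemma has_derivs3_mult:
  assumes "has_derivs3 S f f1 f2 f3" "has_derivs3 S h h1 h2 h3"
  shows "has_derivs3 S (\<lambda>x. f x * h x) (\<lambda>x. f1 x * h x + f x * h1 x)
    (\<lambda>x. f2 x * h x + 2 * f1 x * h1 x + f x * h2 x)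
    (\<lambda>x. f3 x * h x + 3 * f2 x * h1 x + 3 * f1 x * h2 x + f x * h3 x)"
  unfolding has_derivs3_def
  using has_derivs3D[OF assms(1)] has_derivs3D[OF assms(2)]
    has_derivs3_continuous[OF assms(1)] has_derivs3_continuous[OF assms(2)]
  by (auto intro!: derivative_eq_intros continuous_intros simp: algebra_simps)

lemma has_derivs3_compose:
  assumes f: "has_derivs3 S f f1 f2 f3" and h: "has_derivs3 S h h1 h2 h3" and "h ` S \<subseteq> S"
  shows "has_derivs3 S (\<lambda>x. f (h x)) (\<lambda>x. f1 (h x) * h1 x)
    (\<lambda>x. f2 (h x) * (h1 x)\<^sup>2 + f1 (h x) * h2 x)
    (\<lambda>x. f3 (h x) * h1 x ^ 3 + 3 * f2 (h x) * h1 x * h2 x + f1 (h x) * h3 x)"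
proof -
  have chain: "((\<lambda>x. u (h x)) has_real_derivative u' (h x) * h1 x) (at x within S)"
    if "\<And>x. x \<in> S \<Longrightarrow> (u has_real_derivative u' x) (at x within S)" "x \<in> S" for u u' x
  proof -
    have "(u has_real_derivative u' (h x)) (at (h x) within h ` S)"
      using that assms(3) by (blast intro: DERIV_subset)
    from DERIV_image_chain[OF this has_derivs3D(1)[OF h \<open>x \<in> S\<close>]] show ?thesis
      by (simp add: o_def)
  qed
  have cont: "continuous_on S (\<lambda>x. u (h x))" if "continuous_on S u" for u :: "real \<Rightarrow> real"
    using continuous_on_compose2[OF that has_derivs3_continuous(1)[OF h] assms(3)] .
  have "((\<lambda>x. f1 (h x) * h1 x) has_real_derivative f2 (h x) * (h1 x)\<^sup>2 + f1 (h x) * h2 x)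
      (at x within S)" if "x \<in> S" for x
    by (rule DERIV_cong[OF DERIV_mult[OF chain[OF has_derivs3D(2)[OF f] that]
            has_derivs3D(2)[OF h that]]])
      (simp_all add: power2_eq_square)
  moreover have "((\<lambda>x. f2 (h x) * (h1 x)\<^sup>2 + f1 (h x) * h2 x) has_real_derivative
      f3 (h x) * h1 x ^ 3 + 3 * f2 (h x) * h1 x * h2 x + f1 (h x) * h3 x) (at x within S)"
    if "x \<in> S" for x
    by (rule DERIV_cong[OF DERIV_add[OF
            DERIV_mult[OF chain[OF has_derivs3D(3)[OF f] that]
              DERIV_power[OF has_derivs3D(2)[OF h that], where n = 2]]
            DERIV_mult[OF chain[OF has_derivs3D(2)[OF f] that] has_derivs3D(3)[OF h that]]]])
      (simp_all add: power3_eq_cube power2_eq_square algebra_simps)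
  ultimately show ?thesis
    unfolding has_derivs3_def
    using chain[OF has_derivs3D(1)[OF f]] has_derivs3_continuous[OF f] has_derivs3_continuous[OF h]
    by (auto intro!: continuous_intros cont)
qed

lemma has_derivs3_sum:
  assumes "\<And>i. i \<in> I \<Longrightarrow> has_derivs3 S (f i) (f1 i) (f2 i) (f3 i)"
  shows "has_derivs3 S (\<lambda>x. \<Sum>i\<in>I. f i x) (\<lambda>x. \<Sum>i\<in>I. f1 i x)
    (\<lambda>x. \<Sum>i\<in>I. f2 i x) (\<lambda>x. \<Sum>i\<in>I. f3 i x)"
  using assms unfolding has_derivs3_def
  by (auto intro!: DERIV_sum continuous_intros)

lemma has_derivs3_cmult:
  assumes "has_derivs3 S f f1 f2 f3"
  shows "has_derivs3 S (\<lambda>x. c * f x) (\<lambda>x. c * f1 x) (\<lambda>x. c * f2 x) (\<lambda>x. c * f3 x)"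
  using assms unfolding has_derivs3_def
  by (auto intro!: DERIV_cmult continuous_intros)

text \<open>Each derivative is kept as \<open>g x powr s\<close> times a quotient. Up to the factor
  \<open>s\<close> and absolute values, the three quotients are those whose suprema over words are
  \<open>C1\<close>, \<open>K2\<close> and \<open>K3\<close>, and the common factor is the weight in
  the iterated operator.\<close>

lemma has_derivs3_powr:
  fixes g :: "real \<Rightarrow> real"
  assumes g: "has_derivs3 S g g1 g2 g3" and pos: "\<And>x. x \<in> S \<Longrightarrow> g x > 0"
  shows "has_derivs3 S (\<lambda>x. g x powr s)
    (\<lambda>x. g x powr s * (s * (g1 x / g x)))
    (\<lambda>x. g x powr s * (s * ((g2 x * g x - (1 - s) * (g1 x)\<^sup>2) / (g x)\<^sup>2)))
    (\<lambda>x. g x powr s * (s * (((s - 1) * (s - 2) * g1 x ^ 3 + 3 * (s - 1) * g x * g1 x * g2 x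
       + (g x)\<^sup>2 * g3 x) / g x ^ 3)))"
proof -
  note D = has_derivs3D[OF g]
  \<comment> \<open>Writing the lowered exponent as a division restores the factor
    \<open>g x powr s\<close> after each differentiation.\<close>
  have reduce: "g x powr (s - 1) = g x powr s / g x" if "x \<in> S" for x
    using powr_diff[of "g x" s 1] pos[OF that] by simp
  have D0: "((\<lambda>x. g x powr s) has_real_derivative g x powr s * (s * (g1 x / g x))) (at x within S)"
    if "x \<in> S" for x
    by (rule DERIV_cong[OF DERIV_chain2[OF has_real_derivative_powr[OF pos[OF that]] D(1)[OF that]]])
      (simp add: reduce[OF that])
  have "((\<lambda>x. g x powr s * (s * (g1 x / g x))) has_real_derivative
      g x powr s * (s * ((g2 x * g x - (1 - s) * (g1 x)\<^sup>2) / (g x)\<^sup>2))) (at x within S)"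
    if "x \<in> S" for x
    using pos[OF that]
    by (auto intro!: derivative_eq_intros D0 D that simp: reduce[OF that] divide_simps)
      (simp add: algebra_simps power2_eq_square)
  moreover have "((\<lambda>x. g x powr s * (s * ((g2 x * g x - (1 - s) * (g1 x)\<^sup>2) / (g x)\<^sup>2)))
      has_real_derivative g x powr s * (s * (((s - 1) * (s - 2) * g1 x ^ 3
       + 3 * (s - 1) * g x * g1 x * g2 x + (g x)\<^sup>2 * g3 x) / g x ^ 3))) (at x within S)"
    if "x \<in> S" for x
    using pos[OF that]
    by (auto intro!: derivative_eq_intros D0 D that simp: reduce[OF that] divide_simps)
      (simp add: algebra_simps power2_eq_square power3_eq_cube power4_eq_xxxx)
  moreover have "continuous_on S (\<lambda>x. g x powr s * (s * (((s - 1) * (s - 2) * g1 x ^ 3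
       + 3 * (s - 1) * g x * g1 x * g2 x + (g x)\<^sup>2 * g3 x) / g x ^ 3)))"
    using has_derivs3_continuous[OF g] pos
    by (auto intro!: continuous_intros simp: less_imp_neq[THEN not_sym])
  ultimately show ?thesis
    using D0 unfolding has_derivs3_def by blast
qed

lemma has_derivs3_const: "has_derivs3 S (\<lambda>x. c) (\<lambda>x. 0) (\<lambda>x. 0) (\<lambda>x. 0)"
  by (auto simp: has_derivs3_def)

lemma has_derivs3_id: "has_derivs3 S (\<lambda>x. x) (\<lambda>x. 1) (\<lambda>x. 0) (\<lambda>x. 0)"
  by (auto simp: has_derivs3_def intro!: derivative_eq_intros)

section \<open>Words and the iterated eigenvalue equation\<close>

lemma theta_word_Nil: "theta_word \<theta> [] = (\<lambda>x. x)"
  by (auto simp: theta_word_def)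

lemma theta_word_Cons: "theta_word \<theta> (b # \<omega>) = (\<lambda>x. theta_word \<theta> \<omega> (\<theta> b x))"
  by (auto simp: theta_word_def)

lemma g_word_Nil: "g_word g \<theta> [] = (\<lambda>x. 1)"
  by (auto simp: g_word_def)

text \<open>Peeling off the first letter isolates the factor with index 0, evaluated at
  \<open>x\<close> itself; all later factors see the shifted point
  \<open>\<theta> b x\<close>.\<close>

lemma g_word_Cons: "g_word g \<theta> (b # \<omega>) = (\<lambda>x. g b x * g_word g \<theta> \<omega> (\<theta> b x))"
  by (auto simp: g_word_def prod.lessThan_Suc_shift theta_word_Nil theta_word_Cons
      simp del: prod.lessThan_Suc)

lemma theta_word_image:
  assumes "\<And>b. b \<in> B \<Longrightarrow> \<theta> b ` S \<subseteq> S" "set \<omega> \<subseteq> B"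
  shows "theta_word \<theta> \<omega> ` S \<subseteq> S"
  using assms(2)
proof (induction \<omega>)
  case (Cons b \<omega>)
  then show ?case using assms(1)[of b] by (auto simp: theta_word_Cons image_subset_iff)
qed (simp add: theta_word_Nil)

lemma g_word_pos:
  assumes "\<And>b. b \<in> B \<Longrightarrow> \<theta> b ` S \<subseteq> S" "\<And>b x. b \<in> B \<Longrightarrow> x \<in> S \<Longrightarrow> g b x > 0"
    and "set \<omega> \<subseteq> B" "x \<in> S"
  shows "g_word g \<theta> \<omega> x > 0"
  using assms(3,4)
proof (induction \<omega> arbitrary: x)
  case (Cons b \<omega>)
  then show ?case using assms(1,2)[of b] by (auto simp: g_word_Cons image_subset_iff)
qed (simp add: g_word_Nil)

text \<open>Only existence is claimed: the chain rule formulas grow with the word, and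
  \<open>has_derivs3_nderiv\<close> replaces them by iterated derivatives later.\<close>

lemma theta_word_has_derivs3:
  assumes "\<And>b. b \<in> B \<Longrightarrow> \<theta> b ` S \<subseteq> S"
    and "\<And>b. b \<in> B \<Longrightarrow> \<exists>f1 f2 f3. has_derivs3 S (\<theta> b) f1 f2 f3"
    and "set \<omega> \<subseteq> B"
  shows "\<exists>f1 f2 f3. has_derivs3 S (theta_word \<theta> \<omega>) f1 f2 f3"
  using assms(3)
proof (induction \<omega>)
  case Nil
  then show ?case using has_derivs3_id by (auto simp: theta_word_Nil)
next
  case (Cons b \<omega>)
  then obtain f1 f2 f3 h1 h2 h3 where
    "has_derivs3 S (theta_word \<theta> \<omega>) f1 f2 f3" "has_derivs3 S (\<theta> b) h1 h2 h3"
    using assms(2)[of b] by auto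
  from has_derivs3_compose[OF this] assms(1) Cons.prems show ?case
    unfolding theta_word_Cons by (meson list.set_intros(1) subsetD)
qed

lemma g_word_has_derivs3:
  assumes "\<And>b. b \<in> B \<Longrightarrow> \<theta> b ` S \<subseteq> S"
    and "\<And>b. b \<in> B \<Longrightarrow> \<exists>f1 f2 f3. has_derivs3 S (\<theta> b) f1 f2 f3"
    and "\<And>b. b \<in> B \<Longrightarrow> \<exists>f1 f2 f3. has_derivs3 S (g b) f1 f2 f3"
    and "set \<omega> \<subseteq> B"
  shows "\<exists>f1 f2 f3. has_derivs3 S (g_word g \<theta> \<omega>) f1 f2 f3"
  using assms(4)
proof (induction \<omega>)
  case Nil
  then show ?case unfolding g_word_Nil using has_derivs3_const by blast
next
  case (Cons b \<omega>)
  then obtain f1 f2 f3 h1 h2 h3 where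
    *: "has_derivs3 S (g_word g \<theta> \<omega>) f1 f2 f3" "has_derivs3 S (\<theta> b) h1 h2 h3"
    using assms(2)[of b] by auto
  obtain k1 k2 k3 where "has_derivs3 S (g b) k1 k2 k3"
    using Cons.prems assms(3)[of b] by auto
  moreover have "\<theta> b ` S \<subseteq> S" using Cons.prems assms(1)[of b] by simp
  ultimately show ?case
    unfolding g_word_Cons using has_derivs3_mult has_derivs3_compose[OF *] by meson
qed

lemma words_Suc: "words B (Suc n) = (\<lambda>(b, \<omega>). b # \<omega>) ` (B \<times> words B n)"
  by (auto simp: words_def length_Suc_conv)

lemma finite_words: "finite B \<Longrightarrow> finite (words B n)"
  using finite_lists_length_eq by (simp add: words_def)

lemma words_nonempty: "B \<noteq> {} \<Longrightarrow> words B n \<noteq> {}"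
  by (induction n) (auto simp: words_Suc, simp add: words_def)

text \<open>Induction on the length, splitting off the first letter: the rest of the word is handled
  by the induction hypothesis at \<open>\<theta> b x\<close>, which lies in \<open>S\<close>, and
  the remaining sum over first letters is one application of the operator at
  \<open>x\<close>.\<close>

lemma pf_op_iterate_eigen:
  fixes v :: "real \<Rightarrow> real"
  assumes img: "\<And>b. b \<in> B \<Longrightarrow> \<theta> b ` S \<subseteq> S" and pos: "\<And>b x. b \<in> B \<Longrightarrow> x \<in> S \<Longrightarrow> g b x > 0"
    and eig: "\<And>x. x \<in> S \<Longrightarrow> pf_op B g \<theta> s v x = r * v x"
    and "x \<in> S"
  shows "(\<Sum>\<omega>\<in>words B n. g_word g \<theta> \<omega> x powr s * v (theta_word \<theta> \<omega> x)) = r ^ n * v x"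
  using \<open>x \<in> S\<close>
proof (induction n arbitrary: x)
  case 0
  have "words B 0 = {[]}" by (auto simp: words_def)
  then show ?case by (simp add: g_word_Nil theta_word_Nil)
next
  case (Suc n)
  have mem: "\<theta> b x \<in> S" if "b \<in> B" for b using img[OF that] Suc.prems by auto
  have "(\<Sum>\<omega>\<in>words B (Suc n). g_word g \<theta> \<omega> x powr s * v (theta_word \<theta> \<omega> x))
      = (\<Sum>(b, \<omega>)\<in>B \<times> words B n. (g b x * g_word g \<theta> \<omega> (\<theta> b x)) powr s
          * v (theta_word \<theta> \<omega> (\<theta> b x)))"
    unfolding words_Suc
    by (subst sum.reindex) (auto simp: inj_on_def g_word_Cons theta_word_Cons intro!: sum.cong)
  also have "\<dots> = (\<Sum>b\<in>B. \<Sum>\<omega>\<in>words B n. g b x powr s * (g_word g \<theta> \<omega> (\<theta> b x) powr s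
          * v (theta_word \<theta> \<omega> (\<theta> b x))))"
    unfolding sum.cartesian_product[symmetric]
  proof (intro sum.cong refl)
    fix b \<omega> assume "b \<in> B" "\<omega> \<in> words B n"
    then have "0 < g b x" "0 < g_word g \<theta> \<omega> (\<theta> b x)"
      using pos Suc.prems g_word_pos[of B \<theta> S g \<omega>] img mem by (auto simp: words_def)
    then show "(g b x * g_word g \<theta> \<omega> (\<theta> b x)) powr s * v (theta_word \<theta> \<omega> (\<theta> b x))
      = g b x powr s * (g_word g \<theta> \<omega> (\<theta> b x) powr s * v (theta_word \<theta> \<omega> (\<theta> b x)))"
      by (simp add: powr_mult)
  qed
  also have "\<dots> = (\<Sum>b\<in>B. g b x powr s * (r ^ n * v (\<theta> b x)))"
    by (simp add: sum_distrib_left[symmetric] Suc.IH mem)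
  also have "\<dots> = r ^ n * pf_op B g \<theta> s v x"
    by (simp add: pf_op_def sum_distrib_left mult_ac)
  finally show ?case using eig[OF Suc.prems] by simp
qed

section \<open>Suprema, maxima and difference quotients\<close>

text \<open>A real supremum is sure to dominate its elements only when the set is bounded above;
  here the set is a finite union of continuous images of a compact set.\<close>

lemma SUP_finite_times_compact_upper:
  fixes f :: "'a \<Rightarrow> 'c::topological_space \<Rightarrow> real"
  assumes "finite W" "compact S" "\<And>w. w \<in> W \<Longrightarrow> continuous_on S (f w)" "w \<in> W" "x \<in> S"
  shows "f w x \<le> (SUP (w, x)\<in>W \<times> S. f w x)"
proof -
  have "bdd_above (f w ` S)" if "w \<in> W" for w
    using compact_continuous_image[OF assms(3)[OF that] assms(2)]
    by (rule compact_imp_bounded[THEN bounded_imp_bdd_above])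
  then have "bdd_above (\<Union>w\<in>W. f w ` S)"
    using assms(1) by simp
  moreover have "(\<lambda>(w, x). f w x) ` (W \<times> S) = (\<Union>w\<in>W. f w ` S)" by auto
  ultimately show ?thesis
    using assms(4,5) cSUP_upper[of "(w, x)" "W \<times> S" "\<lambda>(w, x). f w x"] by simp
qed

text \<open>Apply the hypothesis at a maximum point of \<open>\<bar>u\<bar> / v\<close>, with \<open>N\<close> the maximum.\<close>

lemma self_improving_bound:
  fixes u v :: "'c::topological_space \<Rightarrow> real"
  assumes "compact S" "continuous_on S u" "continuous_on S v"
    and pos: "\<And>x. x \<in> S \<Longrightarrow> v x > 0" and "q < 1"
    and improve: "\<And>N x. N \<ge> 0 \<Longrightarrow> (\<And>x. x \<in> S \<Longrightarrow> \<bar>u x\<bar> \<le> N * v x) \<Longrightarrow> x \<in> S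
      \<Longrightarrow> \<bar>u x\<bar> \<le> (A + q * N) * v x"
    and "x \<in> S"
  shows "\<bar>u x\<bar> \<le> A / (1 - q) * v x"
proof -
  have "continuous_on S (\<lambda>x. \<bar>u x\<bar> / v x)"
    using assms(2,3) pos by (auto intro!: continuous_intros simp: less_imp_neq[THEN not_sym])
  then obtain z where z: "z \<in> S" "\<And>y. y \<in> S \<Longrightarrow> \<bar>u y\<bar> / v y \<le> \<bar>u z\<bar> / v z"
    using continuous_attains_sup[OF assms(1)] \<open>x \<in> S\<close> by blast
  define N where "N = \<bar>u z\<bar> / v z"
  have N: "N \<ge> 0" "\<bar>u y\<bar> \<le> N * v y" if "y \<in> S" for y
    using z(2)[OF that] pos[OF z(1)] pos[OF that] by (auto simp: N_def pos_divide_le_eq)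
  have "\<bar>u z\<bar> \<le> (A + q * N) * v z"
    using improve N z by blast
  then have "N \<le> A + q * N"
    using pos[OF z(1)] by (simp add: N_def pos_divide_le_eq)
  then have "N \<le> A / (1 - q)"
    using \<open>q < 1\<close> by (simp add: pos_le_divide_eq algebra_simps)
  then have "N * v x \<le> A / (1 - q) * v x"
    using pos[OF \<open>x \<in> S\<close>] by (intro mult_right_mono) auto
  then show ?thesis using N(2)[OF \<open>x \<in> S\<close>] by linarith
qed

text \<open>The difference quotients at \<open>x\<close> are bounded by \<open>L\<close> and pass
  the bound to their limit; \<open>a < b\<close> makes even an endpoint a limit point. This turns
  the contraction hypothesis on words into a bound by \<open>\<kappa>\<close> on their first
  derivatives.\<close>

lemma has_real_derivative_Lipschitz_bound:
  fixes f :: "real \<Rightarrow> real"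
  assumes "a < b" "x \<in> {a..b}" "(f has_real_derivative D) (at x within {a..b})"
    and "\<And>x y. x \<in> {a..b} \<Longrightarrow> y \<in> {a..b} \<Longrightarrow> \<bar>f x - f y\<bar> \<le> L * \<bar>x - y\<bar>"
  shows "\<bar>D\<bar> \<le> L"
proof -
  have "((\<lambda>y. (f y - f x) / (y - x)) \<longlongrightarrow> D) (at x within {a..b})"
    using assms(3) by (simp add: has_field_derivative_iff)
  then have lim: "((\<lambda>y. \<bar>(f y - f x) / (y - x)\<bar>) \<longlongrightarrow> \<bar>D\<bar>) (at x within {a..b})"
    by (rule tendsto_rabs)
  have "\<forall>\<^sub>F y in at x within {a..b}. \<bar>(f y - f x) / (y - x)\<bar> \<le> L"
    using assms(2,4) by (auto simp: eventually_at_filter pos_divide_le_eq)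
  moreover have "at x within {a..b} \<noteq> bot"
    using assms(1,2) islimpt_Icc[of a b x] by (simp add: trivial_limit_within)
  ultimately show ?thesis
    using tendsto_upperbound[OF lim] by blast
qed

section \<open>Relative bounds for the derivatives of the eigenfunction\<close>

theorem theorem5p3:
  fixes a1 a2 \<kappa> s C1 M1 E2 K2 M2 C3 E3 K3 M3 :: real
    and H S :: "real set"
    and B :: "'b set"
    and g \<theta> :: "'b \<Rightarrow> real \<Rightarrow> real"
    and m \<mu> :: nat
    and v :: "real \<Rightarrow> real"
  assumes "a1 < a2" and "H = {a1<..<a2}" and "S = closure H"
    and "finite B" and "B \<noteq> {}"
    and "m \<ge> 3"
    and "\<And>b. b \<in> B \<Longrightarrow> g b \<in> Cm m S"
    and "\<And>b. b \<in> B \<Longrightarrow> \<theta> b \<in> Cm m S"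
    and "\<And>b x. b \<in> B \<Longrightarrow> x \<in> S \<Longrightarrow> g b x > 0"
    and "\<And>b. b \<in> B \<Longrightarrow> \<theta> b ` H \<subseteq> H"
    and "\<mu> \<ge> 1" and "\<kappa> < 1"
    and "\<And>\<omega> x y. \<omega> \<in> words B \<mu> \<Longrightarrow> x \<in> S \<Longrightarrow> y \<in> S \<Longrightarrow>
           \<bar>theta_word \<theta> \<omega> x - theta_word \<theta> \<omega> y\<bar> \<le> \<kappa> * \<bar>x - y\<bar>"
    and "s > 0"
    and "C1 = (SUP (\<omega>, x)\<in>words B \<mu> \<times> S.
           \<bar>nderiv S 1 (g_word g \<theta> \<omega>) x\<bar> / g_word g \<theta> \<omega> x)"
    and "M1 = C1 * s / (1 - \<kappa>)"
    and "E2 = (SUP (\<omega>, x)\<in>words B \<mu> \<times> S. \<bar>nderiv S 2 (theta_word \<theta> \<omega>) x\<bar>)"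
    and "K2 = (SUP (\<omega>, x)\<in>words B \<mu> \<times> S.
           \<bar>nderiv S 2 (g_word g \<theta> \<omega>) x * g_word g \<theta> \<omega> x
             - (1 - s) * (nderiv S 1 (g_word g \<theta> \<omega>) x)^2\<bar> / (g_word g \<theta> \<omega> x)^2)"
    and "M2 = (s * K2 + 2 * s * C1 * M1 * \<kappa> + M1 * E2) / (1 - \<kappa>^2)"
    and "C3 = (SUP (\<omega>, x)\<in>words B \<mu> \<times> S.
           \<bar>nderiv S 3 (g_word g \<theta> \<omega>) x\<bar> / g_word g \<theta> \<omega> x)"
    and "E3 = (SUP (\<omega>, x)\<in>words B \<mu> \<times> S. \<bar>nderiv S 3 (theta_word \<theta> \<omega>) x\<bar>)"
    and "K3 = (SUP (\<omega>, x)\<in>words B \<mu> \<times> S.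
           \<bar>(s - 1) * (s - 2) * (nderiv S 1 (g_word g \<theta> \<omega>) x)^3
             + 3 * (s - 1) * g_word g \<theta> \<omega> x * nderiv S 1 (g_word g \<theta> \<omega>) x
                 * nderiv S 2 (g_word g \<theta> \<omega>) x
             + (g_word g \<theta> \<omega> x)^2 * nderiv S 3 (g_word g \<theta> \<omega>) x\<bar> / (g_word g \<theta> \<omega> x)^3)"
    and "(1 - \<kappa>^3) * M3 = s * K3 + 3 * s * K2 * M1 * \<kappa> + 3 * s * C1 * (M2 * \<kappa>^2 + M1 * E2)
           + 3 * M2 * \<kappa> * E2 + M1 * E3"
    and "v \<in> Cm m S"
    and "\<And>x. x \<in> S \<Longrightarrow> v x > 0"
    and "\<And>x. x \<in> S \<Longrightarrow> pf_op B g \<theta> s v x = Cm_spectral_radius m S (pf_op B g \<theta> s) * v x"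
  shows "(SUP x\<in>S. \<bar>nderiv S 3 v x\<bar> / v x) \<le> M3"
proof -
  note a12 = assms(1) and finB = assms(4) and m3 = assms(6)
    and gpos = assms(9) and contr = assms(13) and spos = assms(14)
    and vCm = assms(24) and vpos = assms(25) and eig = assms(26)
  have S: "S = {a1..a2}" using assms(1,2,3) by simp
  then have cS: "compact S" and neS: "a1 \<in> S" "a2 \<in> S" using a12 by auto
  define W where "W = words B \<mu>"
  define T where "T = theta_word \<theta>"
  define T1 where "T1 \<omega> = nderiv S 1 (T \<omega>)" for \<omega>
  define T2 where "T2 \<omega> = nderiv S 2 (T \<omega>)" for \<omega>
  define T3 where "T3 \<omega> = nderiv S 3 (T \<omega>)" for \<omega>
  define G where "G = g_word g \<theta>"
  define G1 where "G1 \<omega> = nderiv S 1 (G \<omega>)" for \<omega>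
  define G2 where "G2 \<omega> = nderiv S 2 (G \<omega>)" for \<omega>
  define G3 where "G3 \<omega> = nderiv S 3 (G \<omega>)" for \<omega>
  define v1 where "v1 = nderiv S 1 v"
  define v2 where "v2 = nderiv S 2 v"
  define v3 where "v3 = nderiv S 3 v"
  define r where "r = Cm_spectral_radius m S (pf_op B g \<theta> s)"
  have finW: "finite W" and neW: "W \<noteq> {}"
    using finite_words[OF finB] words_nonempty[OF assms(5)] by (auto simp: W_def)
  then obtain \<omega>0 where \<omega>0: "\<omega>0 \<in> W" by blast

  have dB: "\<exists>f1 f2 f3. has_derivs3 S (\<theta> b) f1 f2 f3" "\<exists>f1 f2 f3. has_derivs3 S (g b) f1 f2 f3"
    if "b \<in> B" for b
    using has_derivs3_nderiv_Cm[OF assms(8)[OF that] m3]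
      has_derivs3_nderiv_Cm[OF assms(7)[OF that] m3] by blast+
  \<comment> \<open>The hypothesis concerns the open interval; continuity carries it over to the
    closure, because \<open>S\<close> is closed.\<close>
  have img: "\<theta> b ` S \<subseteq> S" if b: "b \<in> B" for b
  proof -
    have "continuous_on (closure H) (\<theta> b)"
      using dB(1)[OF b] has_derivs3_continuous(1) assms(3) by blast
    then show ?thesis
      using image_closure_subset[of H "\<theta> b" S] assms(10)[OF b] assms(3) closure_subset[of H]
      by (auto intro: order_trans)
  qed
  have WB: "set \<omega> \<subseteq> B" if "\<omega> \<in> W" for \<omega> using that by (auto simp: W_def words_def)
  have Tmem: "T \<omega> x \<in> S" if "\<omega> \<in> W" "x \<in> S" for \<omega> x
    using theta_word_image[of B \<theta> S \<omega>] img WB that unfolding T_def by blast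
  have Gpos: "G \<omega> x > 0" if "\<omega> \<in> W" "x \<in> S" for \<omega> x
    using g_word_pos[of B \<theta> S g \<omega> x] img gpos WB that unfolding G_def by blast
  have dT: "has_derivs3 S (T \<omega>) (T1 \<omega>) (T2 \<omega>) (T3 \<omega>)" if w: "\<omega> \<in> W" for \<omega>
  proof -
    obtain f1 f2 f3 where "has_derivs3 S (T \<omega>) f1 f2 f3"
      using theta_word_has_derivs3[of B \<theta> S \<omega>] img dB(1) WB[OF w] unfolding T_def by blast
    then show ?thesis
      unfolding T1_def T2_def T3_def S by (rule has_derivs3_nderiv[OF a12])
  qed
  have dG: "has_derivs3 S (G \<omega>) (G1 \<omega>) (G2 \<omega>) (G3 \<omega>)" if w: "\<omega> \<in> W" for \<omega>
  proof -
    obtain f1 f2 f3 where "has_derivs3 S (G \<omega>) f1 f2 f3"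
      using g_word_has_derivs3[of B \<theta> S g \<omega>] img dB WB[OF w] unfolding G_def by blast
    then show ?thesis
      unfolding G1_def G2_def G3_def S by (rule has_derivs3_nderiv[OF a12])
  qed
  have dv: "has_derivs3 S v v1 v2 v3"
    unfolding v1_def v2_def v3_def by (rule has_derivs3_nderiv_Cm[OF vCm m3])

  note cont = has_derivs3_continuous[OF dG] has_derivs3_continuous[OF dT] continuous_on_divide
    continuous_intros
  have Gne: "G \<omega> x \<noteq> 0" if "\<omega> \<in> W" "x \<in> S" for \<omega> x using Gpos[OF that] by simp
  \<comment> \<open>The suprema become pointwise bounds; the quotients are continuous because
    \<open>G \<omega>\<close> has no zero on \<open>S\<close>.\<close>
  have C1: "\<bar>G1 \<omega> x\<bar> / G \<omega> x \<le> C1" if "\<omega> \<in> W" "x \<in> S" for \<omega> x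
    unfolding assms(15) W_def[symmetric] G_def[symmetric] G1_def[symmetric]
    by (rule SUP_finite_times_compact_upper[OF finW cS _ that,
        of "\<lambda>\<omega> x. \<bar>G1 \<omega> x\<bar> / G \<omega> x"])
      (auto intro!: cont simp: Gne)
  have E2: "\<bar>T2 \<omega> x\<bar> \<le> E2" if "\<omega> \<in> W" "x \<in> S" for \<omega> x
    unfolding assms(17) W_def[symmetric] T_def[symmetric] T2_def[symmetric]
    by (rule SUP_finite_times_compact_upper[OF finW cS _ that,
        of "\<lambda>\<omega> x. \<bar>T2 \<omega> x\<bar>"])
      (auto intro!: cont simp: Gne)
  have K2: "\<bar>G2 \<omega> x * G \<omega> x - (1 - s) * (G1 \<omega> x)\<^sup>2\<bar> / (G \<omega> x)\<^sup>2 \<le> K2"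
    if "\<omega> \<in> W" "x \<in> S" for \<omega> x
    unfolding assms(18) W_def[symmetric] G_def[symmetric] G1_def[symmetric] G2_def[symmetric]
    by (rule SUP_finite_times_compact_upper[OF finW cS _ that,
        of "\<lambda>\<omega> x. \<bar>G2 \<omega> x * G \<omega> x - (1 - s) * (G1 \<omega> x)\<^sup>2\<bar> / (G \<omega> x)\<^sup>2"])
      (auto intro!: cont simp: Gne)
  have E3: "\<bar>T3 \<omega> x\<bar> \<le> E3" if "\<omega> \<in> W" "x \<in> S" for \<omega> x
    unfolding assms(21) W_def[symmetric] T_def[symmetric] T3_def[symmetric]
    by (rule SUP_finite_times_compact_upper[OF finW cS _ that,
        of "\<lambda>\<omega> x. \<bar>T3 \<omega> x\<bar>"])
      (auto intro!: cont simp: Gne)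
  have K3: "\<bar>(s - 1) * (s - 2) * (G1 \<omega> x) ^ 3 + 3 * (s - 1) * G \<omega> x * G1 \<omega> x * G2 \<omega> x
      + (G \<omega> x)\<^sup>2 * G3 \<omega> x\<bar> / (G \<omega> x) ^ 3 \<le> K3" if "\<omega> \<in> W" "x \<in> S" for \<omega> x
    unfolding assms(22) W_def[symmetric] G_def[symmetric] G1_def[symmetric] G2_def[symmetric]
      G3_def[symmetric]
    by (rule SUP_finite_times_compact_upper[OF finW cS _ that,
        of "\<lambda>\<omega> x.
        \<bar>(s - 1) * (s - 2) * (G1 \<omega> x) ^ 3 + 3 * (s - 1) * G \<omega> x * G1 \<omega> x * G2 \<omega> x
        + (G \<omega> x)\<^sup>2 * G3 \<omega> x\<bar> / (G \<omega> x) ^ 3"])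
      (auto intro!: cont simp: Gne)
  have T1: "\<bar>T1 \<omega> x\<bar> \<le> \<kappa>" if "\<omega> \<in> W" "x \<in> S" for \<omega> x
    using has_real_derivative_Lipschitz_bound[OF a12, of x "T \<omega>" "T1 \<omega> x" \<kappa>]
      has_derivs3D(1)[OF dT[OF that(1)] that(2)] contr[of \<omega>] that
    unfolding S T_def W_def by blast
  \<comment> \<open>Each constant bounds an absolute value, possibly divided by a power of a
    positive number, at the sample point \<open>a1\<close> and word \<open>\<omega>0\<close>. For
    \<open>\<kappa>\<close> this is the bound on \<open>T1\<close>, and it gives the powers of
    \<open>\<kappa>\<close> their bound by 1.\<close>
  have nonneg: "\<kappa> \<ge> 0" "C1 \<ge> 0" "E2 \<ge> 0" "K2 \<ge> 0" "E3 \<ge> 0" "K3 \<ge> 0"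
    using T1[OF \<omega>0 neS(1)] C1[OF \<omega>0 neS(1)] E2[OF \<omega>0 neS(1)] K2[OF \<omega>0 neS(1)]
      E3[OF \<omega>0 neS(1)] K3[OF \<omega>0 neS(1)] Gpos[OF \<omega>0 neS(1)]
    by (smt (verit) divide_nonneg_pos zero_less_power abs_ge_zero)+
  have kpow: "\<kappa>\<^sup>2 < 1" "\<kappa> ^ 3 < 1"
    using nonneg(1) assms(12) by (simp_all add: power_less_one_iff)
  have M1_nonneg: "M1 \<ge> 0" using nonneg spos assms(12) by (simp add: assms(16))
  have M2_nonneg: "M2 \<ge> 0"
    using nonneg spos M1_nonneg kpow by (simp add: assms(19))

  \<comment> \<open>\<open>p1\<close>, \<open>p2\<close>, \<open>p3\<close> are the first three
    derivatives of the weight \<open>G \<omega> x powr s\<close>, each divided by the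
    weight.\<close>
  define p1 where "p1 \<omega> x = s * (G1 \<omega> x / G \<omega> x)" for \<omega> x
  define p2 where "p2 \<omega> x = s * ((G2 \<omega> x * G \<omega> x - (1 - s) * (G1 \<omega> x)\<^sup>2) / (G \<omega> x)\<^sup>2)" for \<omega> x
  define p3 where "p3 \<omega> x = s * (((s - 1) * (s - 2) * G1 \<omega> x ^ 3
    + 3 * (s - 1) * G \<omega> x * G1 \<omega> x * G2 \<omega> x + (G \<omega> x)\<^sup>2 * G3 \<omega> x) / G \<omega> x ^ 3)" for \<omega> x
  have p1: "\<bar>p1 \<omega> x\<bar> \<le> s * C1" if "\<omega> \<in> W" "x \<in> S" for \<omega> x
    using mult_left_mono[OF C1[OF that], of s] spos Gpos[OF that] by (simp add: p1_def abs_mult)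
  have p2: "\<bar>p2 \<omega> x\<bar> \<le> s * K2" if "\<omega> \<in> W" "x \<in> S" for \<omega> x
    using mult_left_mono[OF K2[OF that], of s] spos Gpos[OF that] by (simp add: p2_def abs_mult)
  have p3: "\<bar>p3 \<omega> x\<bar> \<le> s * K3" if "\<omega> \<in> W" "x \<in> S" for \<omega> x
    using mult_left_mono[OF K3[OF that], of s] spos Gpos[OF that] by (simp add: p3_def abs_mult)

  \<comment> \<open>The chain rule gives \<open>V1\<close>, \<open>V2\<close>, \<open>V3\<close> as
    the derivatives of \<open>v (T \<omega> x)\<close>; the Leibniz rule gives \<open>D1\<close>,
    \<open>D2\<close>, \<open>D3\<close> as those of its product with the weight
    \<open>Q \<omega> x\<close>.\<close>
  define V1 where "V1 \<omega> x = v1 (T \<omega> x) * T1 \<omega> x" for \<omega> x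
  define V2 where "V2 \<omega> x = v2 (T \<omega> x) * (T1 \<omega> x)\<^sup>2 + v1 (T \<omega> x) * T2 \<omega> x" for \<omega> x
  define V3 where "V3 \<omega> x = v3 (T \<omega> x) * T1 \<omega> x ^ 3 + 3 * v2 (T \<omega> x) * T1 \<omega> x * T2 \<omega> x
    + v1 (T \<omega> x) * T3 \<omega> x" for \<omega> x
  define Q where "Q \<omega> x = G \<omega> x powr s" for \<omega> x
  define D1 where "D1 \<omega> x = Q \<omega> x * p1 \<omega> x * v (T \<omega> x) + Q \<omega> x * V1 \<omega> x" for \<omega> x
  define D2 where "D2 \<omega> x = Q \<omega> x * p2 \<omega> x * v (T \<omega> x) + 2 * (Q \<omega> x * p1 \<omega> x) * V1 \<omega> x
    + Q \<omega> x * V2 \<omega> x" for \<omega> x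
  define D3 where "D3 \<omega> x = Q \<omega> x * p3 \<omega> x * v (T \<omega> x) + 3 * (Q \<omega> x * p2 \<omega> x) * V1 \<omega> x
    + 3 * (Q \<omega> x * p1 \<omega> x) * V2 \<omega> x + Q \<omega> x * V3 \<omega> x" for \<omega> x
  have "has_derivs3 S (\<lambda>x. Q \<omega> x * v (T \<omega> x)) (D1 \<omega>) (D2 \<omega>) (D3 \<omega>)" if "\<omega> \<in> W" for \<omega>
  proof -
    have "T \<omega> ` S \<subseteq> S" using Tmem that by auto
    from has_derivs3_mult[OF has_derivs3_powr[where s = s, OF dG[OF that] Gpos[OF that]]
        has_derivs3_compose[OF dv dT[OF that] this]]
    show ?thesis
      by (rule has_derivs3_cong)
        (auto simp: Q_def D1_def D2_def D3_def V1_def V2_def V3_def p1_def p2_def p3_def)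
  qed
  then have dsum: "has_derivs3 S (\<lambda>x. \<Sum>\<omega>\<in>W. Q \<omega> x * v (T \<omega> x))
      (\<lambda>x. \<Sum>\<omega>\<in>W. D1 \<omega> x) (\<lambda>x. \<Sum>\<omega>\<in>W. D2 \<omega> x) (\<lambda>x. \<Sum>\<omega>\<in>W. D3 \<omega> x)"
    by (rule has_derivs3_sum)
  have iter: "(\<Sum>\<omega>\<in>W. Q \<omega> x * v (T \<omega> x)) = r ^ \<mu> * v x" if "x \<in> S" for x
    unfolding Q_def W_def G_def T_def
    by (rule pf_op_iterate_eigen[OF img gpos]) (use eig that in \<open>auto simp: r_def\<close>)
  \<comment> \<open>Differentiating the iterated equation: at every order, the sum of the
    \<open>D\<close> terms over \<open>W\<close> equals \<open>r ^ \<mu>\<close> times the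
    derivative of \<open>v\<close>.\<close>
  note derivs_eq = has_derivs3_unique[OF a12 dsum[unfolded S] has_derivs3_cmult[OF dv, unfolded S],
      folded S, OF iter]
  have Qpos: "Q \<omega> x > 0" if "\<omega> \<in> W" "x \<in> S" for \<omega> x using Gne[OF that] by (simp add: Q_def)
  \<comment> \<open>The sign is read off the iterated equation at \<open>a1\<close>: a nonempty sum
    of positive terms equals \<open>r ^ \<mu> * v a1\<close>, and \<open>v a1\<close> is
    positive.\<close>
  have rpos: "r ^ \<mu> > 0"
  proof -
    have "(\<Sum>\<omega>\<in>W. Q \<omega> a1 * v (T \<omega> a1)) > 0"
      using neS Qpos vpos Tmem by (intro sum_pos finW neW) auto
    then show ?thesis
      using iter[OF neS(1)] vpos[OF neS(1)] by (simp add: zero_less_mult_iff)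
  qed
  \<comment> \<open>\<open>r ^ \<mu> * v\<close> is itself the sum of the \<open>Q \<omega> x * v (T \<omega> x)\<close>, so termwise bounds relative to
    these weights transfer to \<open>v\<close> without loss.\<close>
  have transfer: "\<bar>u\<bar> \<le> A * v x"
    if "(\<Sum>\<omega>\<in>W. D \<omega>) = r ^ \<mu> * u" "x \<in> S"
      "\<And>\<omega>. \<omega> \<in> W \<Longrightarrow> \<bar>D \<omega>\<bar> \<le> Q \<omega> x * (A * v (T \<omega> x))" for u A x and D :: "'b list \<Rightarrow> real"
  proof -
    have "r ^ \<mu> * \<bar>u\<bar> = \<bar>\<Sum>\<omega>\<in>W. D \<omega>\<bar>" using that(1) rpos by (simp add: abs_mult)
    also have "\<dots> \<le> (\<Sum>\<omega>\<in>W. Q \<omega> x * (A * v (T \<omega> x)))"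
      by (rule order_trans[OF sum_abs sum_mono]) (rule that(3))
    also have "\<dots> = A * (\<Sum>\<omega>\<in>W. Q \<omega> x * v (T \<omega> x))"
      by (simp add: sum_distrib_left mult_ac)
    also have "\<dots> = r ^ \<mu> * (A * v x)" using iter[OF that(2)] by simp
    finally show ?thesis using rpos by simp
  qed
  have abs_prod: "\<bar>a * b\<bar> \<le> c * d" if "\<bar>a\<bar> \<le> c" "\<bar>b\<bar> \<le> d" for a b c d :: real
    using that by (simp add: abs_mult mult_mono')
  have T1pow: "\<bar>(T1 \<omega> x) ^ k\<bar> \<le> \<kappa> ^ k" if "\<omega> \<in> W" "x \<in> S" for \<omega> x k
    unfolding power_abs by (intro power_mono T1 that abs_ge_zero)
  have vT: "\<bar>v (T \<omega> x)\<bar> \<le> v (T \<omega> x)" if "\<omega> \<in> W" "x \<in> S" for \<omega> x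
    using vpos[OF Tmem[OF that]] by simp

  \<comment> \<open>The bounds of order one, two and three in turn\<close>
  have V1_bound: "\<bar>V1 \<omega> x\<bar> \<le> N * v (T \<omega> x) * \<kappa>"
    if "\<And>y. y \<in> S \<Longrightarrow> \<bar>v1 y\<bar> \<le> N * v y" "\<omega> \<in> W" "x \<in> S" for N \<omega> x
    unfolding V1_def by (intro abs_prod that(1) Tmem T1 that(2,3))
  have B1: "\<bar>v1 x\<bar> \<le> M1 * v x" if "x \<in> S" for x
  proof -
    \<comment> \<open>Here \<open>s * C1\<close> comes from differentiating the weight and the
      improvement factor \<open>\<kappa>\<close> from the inner derivative \<open>T1\<close>; the
      resulting quotient is \<open>M1\<close>.\<close>
    have "\<bar>v1 x\<bar> \<le> (s * C1) / (1 - \<kappa>) * v x"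
    proof (rule self_improving_bound[OF cS has_derivs3_continuous(2,1)[OF dv] vpos assms(12) _ that])
      fix N x assume N: "\<And>x. x \<in> S \<Longrightarrow> \<bar>v1 x\<bar> \<le> N * v x" and x: "x \<in> S"
      show "\<bar>v1 x\<bar> \<le> (s * C1 + \<kappa> * N) * v x"
      proof (rule transfer[OF derivs_eq(1)[OF _ x] x])
        fix \<omega> assume w: "\<omega> \<in> W"
        have "\<bar>p1 \<omega> x * v (T \<omega> x)\<bar> \<le> s * C1 * v (T \<omega> x)"
          by (intro abs_prod p1 vT w x)
        with V1_bound[OF N w x]
        have "\<bar>p1 \<omega> x * v (T \<omega> x) + V1 \<omega> x\<bar> \<le> (s * C1 + \<kappa> * N) * v (T \<omega> x)"
          by (simp add: algebra_simps)
        moreover have "D1 \<omega> x = Q \<omega> x * (p1 \<omega> x * v (T \<omega> x) + V1 \<omega> x)"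
          by (simp add: D1_def algebra_simps)
        ultimately show "\<bar>D1 \<omega> x\<bar> \<le> Q \<omega> x * ((s * C1 + \<kappa> * N) * v (T \<omega> x))"
          using Qpos[OF w x] by (simp add: abs_mult)
      qed
    qed
    then show ?thesis by (simp add: assms(16) mult.commute)
  qed
  \<comment> \<open>\<open>V1_bound\<close> holds for every \<open>N\<close> that bounds
    \<open>v1\<close> relative to \<open>v\<close>: a trial value inside the proof of
    \<open>B1\<close>, and \<open>M1\<close> from here on. \<open>V2_bound\<close> is treated alike
    after \<open>B2\<close>.\<close>
  note V1_bound = V1_bound[OF B1]

  have V2_bound: "\<bar>V2 \<omega> x\<bar> \<le> N * v (T \<omega> x) * \<kappa>\<^sup>2 + M1 * v (T \<omega> x) * E2"
    if "\<And>y. y \<in> S \<Longrightarrow> \<bar>v2 y\<bar> \<le> N * v y" "\<omega> \<in> W" "x \<in> S" for N \<omega> x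
    unfolding V2_def
    by (intro order_trans[OF abs_triangle_ineq] add_mono abs_prod that(1) B1 Tmem T1pow E2 that(2,3))
  have B2: "\<bar>v2 x\<bar> \<le> M2 * v x" if "x \<in> S" for x
  proof -
    \<comment> \<open>The summands come from \<open>p2\<close> times \<open>v\<close>, from the
      doubled cross term of \<open>p1\<close> and \<open>V1\<close>, and from the \<open>T2\<close>
      part of \<open>V2\<close>; the \<open>v2\<close> part of \<open>V2\<close> supplies
      \<open>\<kappa>\<^sup>2 * N\<close>.\<close>
    let ?A = "s * K2 + 2 * s * C1 * M1 * \<kappa> + M1 * E2"
    have "\<bar>v2 x\<bar> \<le> ?A / (1 - \<kappa>\<^sup>2) * v x"
    proof (rule self_improving_bound[OF cS has_derivs3_continuous(3,1)[OF dv] vpos kpow(1) _ that])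
      fix N x assume N: "\<And>x. x \<in> S \<Longrightarrow> \<bar>v2 x\<bar> \<le> N * v x" and x: "x \<in> S"
      show "\<bar>v2 x\<bar> \<le> (?A + \<kappa>\<^sup>2 * N) * v x"
      proof (rule transfer[OF derivs_eq(2)[OF _ x] x])
        fix \<omega> assume w: "\<omega> \<in> W"
        have "\<bar>p2 \<omega> x * v (T \<omega> x)\<bar> \<le> s * K2 * v (T \<omega> x)"
          by (intro abs_prod p2 vT w x)
        moreover have "\<bar>p1 \<omega> x * V1 \<omega> x\<bar> \<le> s * C1 * (M1 * v (T \<omega> x) * \<kappa>)"
          by (intro abs_prod p1 V1_bound w x)
        ultimately have "\<bar>p2 \<omega> x * v (T \<omega> x) + 2 * (p1 \<omega> x * V1 \<omega> x) + V2 \<omega> x\<bar>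
            \<le> (?A + \<kappa>\<^sup>2 * N) * v (T \<omega> x)"
          using V2_bound[OF N w x] by (simp add: algebra_simps)
        moreover have "D2 \<omega> x = Q \<omega> x * (p2 \<omega> x * v (T \<omega> x) + 2 * (p1 \<omega> x * V1 \<omega> x) + V2 \<omega> x)"
          by (simp add: D2_def algebra_simps)
        ultimately show "\<bar>D2 \<omega> x\<bar> \<le> Q \<omega> x * ((?A + \<kappa>\<^sup>2 * N) * v (T \<omega> x))"
          using Qpos[OF w x] by (simp add: abs_mult)
      qed
    qed
    then show ?thesis by (simp add: assms(19))
  qed
  note V2_bound = V2_bound[OF B2]

  have V3_bound: "\<bar>V3 \<omega> x\<bar> \<le> N * v (T \<omega> x) * \<kappa> ^ 3 + 3 * (M2 * v (T \<omega> x)) * \<kappa> * E2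
      + M1 * v (T \<omega> x) * E3"
    if "\<And>y. y \<in> S \<Longrightarrow> \<bar>v3 y\<bar> \<le> N * v y" "\<omega> \<in> W" "x \<in> S" for N \<omega> x
    unfolding V3_def
    by (intro order_trans[OF abs_triangle_ineq] add_mono abs_prod that(1) B1 B2 Tmem T1 T1pow E2 E3
        that(2,3)) simp
  have B3: "\<bar>v3 x\<bar> \<le> M3 * v x" if "x \<in> S" for x
  proof -
    \<comment> \<open>In order, the summands bound \<open>p3\<close> times \<open>v\<close>, three
      times \<open>p2\<close> with \<open>V1\<close>, three times \<open>p1\<close> with
      \<open>V2\<close>, and the two parts of \<open>V3\<close> without \<open>v3\<close>; the part
      with \<open>v3\<close> supplies \<open>\<kappa> ^ 3 * N\<close>.\<close>
    let ?A = "s * K3 + 3 * s * K2 * M1 * \<kappa> + 3 * s * C1 * (M2 * \<kappa>\<^sup>2 + M1 * E2)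
      + 3 * M2 * \<kappa> * E2 + M1 * E3"
    have "\<bar>v3 x\<bar> \<le> ?A / (1 - \<kappa> ^ 3) * v x"
    proof (rule self_improving_bound[OF cS has_derivs3_continuous(4,1)[OF dv] vpos kpow(2) _ that])
      fix N x assume N: "\<And>x. x \<in> S \<Longrightarrow> \<bar>v3 x\<bar> \<le> N * v x" and x: "x \<in> S"
      show "\<bar>v3 x\<bar> \<le> (?A + \<kappa> ^ 3 * N) * v x"
      proof (rule transfer[OF derivs_eq(3)[OF _ x] x])
        fix \<omega> assume w: "\<omega> \<in> W"
        have "\<bar>p3 \<omega> x * v (T \<omega> x)\<bar> \<le> s * K3 * v (T \<omega> x)"
          by (intro abs_prod p3 vT w x)
        moreover have "\<bar>p2 \<omega> x * V1 \<omega> x\<bar> \<le> s * K2 * (M1 * v (T \<omega> x) * \<kappa>)"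
          by (intro abs_prod p2 V1_bound w x)
        moreover have "\<bar>p1 \<omega> x * V2 \<omega> x\<bar>
            \<le> s * C1 * (M2 * v (T \<omega> x) * \<kappa>\<^sup>2 + M1 * v (T \<omega> x) * E2)"
          by (intro abs_prod p1 V2_bound w x)
        ultimately have "\<bar>p3 \<omega> x * v (T \<omega> x) + 3 * (p2 \<omega> x * V1 \<omega> x) + 3 * (p1 \<omega> x * V2 \<omega> x)
            + V3 \<omega> x\<bar> \<le> (?A + \<kappa> ^ 3 * N) * v (T \<omega> x)"
          using V3_bound[OF N w x] by (simp add: algebra_simps)
        moreover have "D3 \<omega> x = Q \<omega> x * (p3 \<omega> x * v (T \<omega> x) + 3 * (p2 \<omega> x * V1 \<omega> x)
            + 3 * (p1 \<omega> x * V2 \<omega> x) + V3 \<omega> x)"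
          by (simp add: D3_def algebra_simps)
        ultimately show "\<bar>D3 \<omega> x\<bar> \<le> Q \<omega> x * ((?A + \<kappa> ^ 3 * N) * v (T \<omega> x))"
          using Qpos[OF w x] by (simp add: abs_mult)
      qed
    qed
    \<comment> \<open>\<open>M3\<close> is given only through its product with
      \<open>1 - \<kappa> ^ 3\<close>, which is positive and can be divided out.\<close>
    moreover have "?A / (1 - \<kappa> ^ 3) = M3"
      using kpow(2) unfolding assms(23)[symmetric] by simp
    ultimately show ?thesis by simp
  qed
  show ?thesis
    using neS B3 vpos unfolding v3_def[symmetric]
    by (intro cSUP_least) (auto simp: pos_divide_le_eq)
qed

end
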